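(* The function $\delta_S^2(X,Y)$ is jointly geodesically convex for $n\times n$ Hermitian positive definite $X,Y$; that is, for all Hermitian positive definite $X_1,X_2,Y_1,Y_2$ of size $n\times n$ and all $t\in[0,1]$, $$\delta_S^2(X_1\sharp_t X_2,\;Y_1\sharp_t Y_2)\le (1-t)\,\delta_S^2(X_1,Y_1)+t\,\delta_S^2(X_2,Y_2).$$
   Context: For Hermitian positive definite $X,Y$: $\delta_S^2(X,Y):=\log\det\left(\frac{X+Y}{2}\right)-\frac12\log\det(XY)$. For Hermitian positive definite $A,B$ and $t\in[0,1]$, $A\sharp_t B:=A^{1/2}(A^{-1/2}BA^{-1/2})^tA^{1/2}$ is the point at parameter $t$ on the geodesic from $A$ to $B$ for the Riemannian metric $ds=\|A^{-1/2}\,dA\,A^{-1/2}\|_F$. *)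

theory Defs
  imports Complex_Main "Jordan_Normal_Form.Schur_Decomposition"
begin

definition unitary_mats :: "nat \<Rightarrow> complex mat set" where
  "unitary_mats n = {U \<in> carrier_mat n n. mat_adjoint U * U = 1\<^sub>m n}"

text \<open>The term \<open>(A *\<^sub>v v) \<bullet>c v\<close> is $v^* A v$, which is real because $A$ is Hermitian.\<close>

definition hpd_mats :: "nat \<Rightarrow> complex mat set" where
  "hpd_mats n = {A \<in> carrier_mat n n. mat_adjoint A = A \<and>
     (\<forall>v \<in> carrier_vec n. v \<noteq> 0\<^sub>v n \<longrightarrow> Re ((A *\<^sub>v v) \<bullet>c v) > 0)}"

text \<open>Spectral functional calculus: if $A = U D U^*$ with $U$ unitary and $D$ real diagonal,
  then $f(A) = U f(D) U^*$. Every Hermitian $A$ has such a decomposition and $f(A)$ does not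
  depend on its choice, so the definite description is proper on Hermitian matrices; on other
  matrices the value is unspecified.\<close>

definition herm_fun :: "(real \<Rightarrow> real) \<Rightarrow> complex mat \<Rightarrow> complex mat" where
  "herm_fun f A = (THE F. \<exists>U \<in> unitary_mats (dim_row A). \<exists>d :: nat \<Rightarrow> real.
     A = U * mat_diag (dim_row A) (\<lambda>i. complex_of_real (d i)) * mat_adjoint U \<and>
     F = U * mat_diag (dim_row A) (\<lambda>i. complex_of_real (f (d i))) * mat_adjoint U)"

definition mat_powr :: "complex mat \<Rightarrow> real \<Rightarrow> complex mat" where
  "mat_powr A p = herm_fun (\<lambda>x. x powr p) A"

definition geodesic_point :: "complex mat \<Rightarrow> real \<Rightarrow> complex mat \<Rightarrow> complex mat"
  ("(_ \<sharp>\<^bsub>_\<^esub> _)" [71, 0, 71] 70) where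
  "A \<sharp>\<^bsub>t\<^esub> B =
     mat_powr A (1/2) * mat_powr (mat_powr A (-1/2) * B * mat_powr A (-1/2)) t * mat_powr A (1/2)"

text \<open>For Hermitian positive definite $X, Y$ both determinants are positive reals, although
  $XY$ need not be Hermitian; \<open>Re\<close> only changes the type.\<close>

definition delta_S_sq :: "complex mat \<Rightarrow> complex mat \<Rightarrow> real" where
  "delta_S_sq X Y = ln (Re (det ((1/2) \<cdot>\<^sub>m (X + Y)))) - 1/2 * ln (Re (det (X * Y)))"

end

theory Submission
  imports Defs "Jordan_Normal_Form.Spectral_Radius"
begin

text \<open>A congruence \<open>C\<close> diagonalises the whole geodesic from \<open>X\<^sub>1\<close> to \<open>X\<^sub>2\<close> at once: the point at
  parameter \<open>t\<close> is \<open>C diag(e\<^sub>i\<^sup>t) C*\<close>; likewise for \<open>Y\<^sub>1\<close>, \<open>Y\<^sub>2\<close> with some \<open>C'\<close>, \<open>e'\<close>. Hence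
  \<open>log det\<close> is affine along each geodesic. By Cauchy--Binet applied to \<open>[C C']\<close>, the determinant
  of the sum of the two geodesic points is a sum of exponentials in \<open>t\<close> with nonnegative
  coefficients, and such a sum is log-convex.\<close>

section \<open>Determinants of weighted Gram matrices\<close>

lemma permutes_nat_less: "p permutes {0..<n} \<Longrightarrow> i < n \<Longrightarrow> p i < n" for n :: nat
  using permutes_in_image[of p "{0..<n}" i] by simp

lemma det_permute_cols:
  fixes A :: "'a :: comm_ring_1 mat"
  assumes A: "A \<in> carrier_mat n n" and p: "p permutes {0..<n}"
  shows "det (mat n n (\<lambda>(i,j). A $$ (i, p j))) = signof p * det A"
proof -
  have "mat n n (\<lambda>(i,j). A $$ (i, p j)) = transpose_mat (mat n n (\<lambda>(i,j). transpose_mat A $$ (p i, j)))"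
    using A permutes_in_image[OF p] by (intro eq_matI) auto
  hence "det (mat n n (\<lambda>(i,j). A $$ (i, p j))) = det (mat n n (\<lambda>(i,j). transpose_mat A $$ (p i, j)))"
    by (simp add: det_transpose[of _ n])
  also have "\<dots> = signof p * det A"
    using det_permute_rows[of "transpose_mat A" n p] A p by (simp add: det_transpose[OF A])
  finally show ?thesis .
qed

text \<open>Precomposition with \<open>p\<close> is a bijection of the index set, inverted by
  precomposition with the inverse permutation. Maps stay extensional because a permutation of
  \<open>I\<close> fixes every point outside \<open>I\<close>.\<close>

lemma sum_PiE_permute:
  fixes F :: "('a \<Rightarrow> 'b) \<Rightarrow> 'c :: comm_monoid_add"
  assumes p: "p permutes I"
  shows "(\<Sum>g\<in>I \<rightarrow>\<^sub>E K. F (g \<circ> p)) = (\<Sum>g\<in>I \<rightarrow>\<^sub>E K. F g)"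
proof -
  have closed: "g \<circ> q \<in> I \<rightarrow>\<^sub>E K" if "g \<in> I \<rightarrow>\<^sub>E K" "q permutes I" for g q
    using that permutes_in_image[OF that(2)] by (auto simp: PiE_iff extensional_def permutes_not_in)
  show ?thesis
    by (rule sum.reindex_bij_witness[where i = "\<lambda>g. g \<circ> Hilbert_Choice.inv p" and j = "\<lambda>g. g \<circ> p"])
      (use closed p permutes_inv[OF p] permutes_inv_o[OF p] in \<open>auto simp: o_assoc[symmetric]\<close>)
qed

text \<open>The Cauchy--Binet formula, summed over all maps rather than over subsets; each
  \<open>n\<close>-subset is then counted \<open>n!\<close> times and non-injective maps contribute zero.\<close>

lemma det_weighted_gram:
  fixes c :: "nat \<Rightarrow> 'k \<Rightarrow> complex" and d :: "'k \<Rightarrow> real"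
  assumes K: "finite K"
  shows "fact n * det (mat n n (\<lambda>(i,j). \<Sum>k\<in>K. c i k * of_real (d k) * cnj (c j k))) =
    (\<Sum>g\<in>{0..<n} \<rightarrow>\<^sub>E K. of_real ((cmod (det (mat n n (\<lambda>(i,j). c i (g j)))))\<^sup>2 * (\<Prod>i=0..<n. d (g i))))"
    (is "_ * det ?M = _")
proof -
  let ?G = "{0..<n} \<rightarrow>\<^sub>E K"
  let ?P = "{p. p permutes {0..<n}}"
  define N where "N g = mat n n (\<lambda>(i,j). c i (g j))" for g
  \<comment> \<open>Expanding each row's sum picks one index \<open>g i\<close> per row.
    \<open>F g\<close> is the total contribution of the choice \<open>g\<close>, with the sum over
    permutations collected into \<open>cnj (det (N g))\<close>.\<close>
  define F where "F g = of_real (\<Prod>i=0..<n. d (g i)) * (\<Prod>i=0..<n. c i (g i)) * cnj (det (N g))" for g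
  have N: "N g \<in> carrier_mat n n" for g by (simp add: N_def)
  have cnj_det: "cnj (det (N g)) = (\<Sum>p\<in>?P. signof p * (\<Prod>i=0..<n. cnj (c (p i) (g i))))" for g
    unfolding mat_det_left_def[OF N]
    by (auto simp: N_def permutes_nat_less intro!: sum.cong prod.cong)
  have "det ?M = (\<Sum>p\<in>?P. signof p * (\<Prod>i=0..<n. \<Sum>k\<in>K. c i k * of_real (d k) * cnj (c (p i) k)))"
    by (subst det_def'[of _ n]) (auto intro!: sum.cong prod.cong simp: permutes_nat_less)
  also have "\<dots> = (\<Sum>p\<in>?P. \<Sum>g\<in>?G. signof p * (\<Prod>i=0..<n. c i (g i) * of_real (d (g i)) * cnj (c (p i) (g i))))"
    by (subst prod_sum_PiE) (use K in \<open>auto simp: sum_distrib_left\<close>)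
  also have "\<dots> = (\<Sum>g\<in>?G. \<Sum>p\<in>?P. signof p * (\<Prod>i=0..<n. c i (g i) * of_real (d (g i)) * cnj (c (p i) (g i))))"
    by (rule sum.swap)
  also have "\<dots> = (\<Sum>g\<in>?G. F g)"
    by (simp add: F_def cnj_det sum_distrib_left prod.distrib mult_ac)
  finally have det: "det ?M = (\<Sum>g\<in>?G. F g)" .
  \<comment> \<open>Passing from \<open>g\<close> to \<open>g \<circ> p\<close> keeps the weight,
    multiplies the conjugated determinant by the sign of \<open>p\<close>, and turns the diagonal
    product into the Leibniz term of \<open>p\<close> in \<open>det (N g)\<close>.\<close>
  have F_perm: "F (g \<circ> p) = of_real (\<Prod>i=0..<n. d (g i)) * cnj (det (N g)) * (signof p * (\<Prod>i=0..<n. N g $$ (i, p i)))"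
    if p: "p permutes {0..<n}" for g p
  proof -
    have "N (g \<circ> p) = mat n n (\<lambda>(i,j). N g $$ (i, p j))"
      using p by (intro eq_matI) (auto simp: N_def permutes_nat_less)
    hence "det (N (g \<circ> p)) = signof p * det (N g)"
      using det_permute_cols[OF N p] by simp
    moreover have "(\<Prod>i=0..<n. d ((g \<circ> p) i)) = (\<Prod>i=0..<n. d (g i))"
      using prod.permute[OF p, of "\<lambda>i. d (g i)"] by (simp add: o_def)
    moreover have "(\<Prod>i=0..<n. c i ((g \<circ> p) i)) = (\<Prod>i=0..<n. N g $$ (i, p i))"
      using p by (intro prod.cong) (auto simp: N_def permutes_nat_less)
    ultimately show ?thesis by (simp add: F_def mult_ac)
  qed
  \<comment> \<open>Symmetrisation: of the \<open>n!\<close> copies of the sum, the one belonging to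
    \<open>p\<close> is relabelled by \<open>p\<close>. Summing over \<open>p\<close> first then
    completes \<open>det (N g)\<close>, which meets its conjugate.\<close>
  have "fact n * det ?M = (\<Sum>p\<in>?P. \<Sum>g\<in>?G. F g)"
    using card_permutations[of "{0..<n}" n] by (simp add: det)
  also have "\<dots> = (\<Sum>p\<in>?P. \<Sum>g\<in>?G. F (g \<circ> p))"
    by (rule sum.cong[OF refl], rule sum_PiE_permute[symmetric]) simp
  also have "\<dots> = (\<Sum>g\<in>?G. \<Sum>p\<in>?P. F (g \<circ> p))"
    by (rule sum.swap)
  also have "\<dots> = (\<Sum>g\<in>?G. of_real (\<Prod>i=0..<n. d (g i)) * cnj (det (N g)) * det (N g))"
    unfolding det_def'[OF N] sum_distrib_left
    by (intro sum.cong refl) (simp add: F_perm det_def'[OF N])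
  also have "\<dots> = (\<Sum>g\<in>?G. of_real ((cmod (det (N g)))\<^sup>2 * (\<Prod>i=0..<n. d (g i))))"
    by (simp only: of_real_mult complex_norm_square mult_ac)
  finally show ?thesis by (simp add: N_def)
qed

section \<open>Log-convexity\<close>

text \<open>This is the weighted arithmetic-geometric mean inequality for 1 and \<open>y\<close>. It
  follows from \<open>exp x \<ge> 1 + x\<close> at \<open>- (t * ln y)\<close> and
  \<open>(1 - t) * ln y\<close>, whose average with weights \<open>1 - t\<close> and
  \<open>t\<close> is 0.\<close>

lemma powr_le_affine:
  fixes y t :: real
  assumes y: "y > 0" and t: "0 \<le> t" "t \<le> 1"
  shows "y powr t \<le> 1 - t + t * y"
proof -
  define u where "u = y powr t"
  have u: "u > 0" using y by (simp add: u_def)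
  have e1: "1 - t * ln y \<le> 1 / u"
    using exp_ge_add_one_self[of "- (t * ln y)"] y by (simp add: u_def powr_def exp_minus inverse_eq_divide)
  have e2: "1 + (1 - t) * ln y \<le> y / u"
    using exp_ge_add_one_self[of "(1 - t) * ln y"] y
    by (simp add: u_def powr_def left_diff_distrib exp_diff)
  have "1 = (1 - t) * (1 - t * ln y) + t * (1 + (1 - t) * ln y)"
    by (simp add: algebra_simps)
  also have "\<dots> \<le> (1 - t) * (1 / u) + t * (y / u)"
    using e1 e2 t by (intro add_mono mult_left_mono) auto
  also have "\<dots> = (1 - t + t * y) / u"
    by (simp add: add_divide_distrib)
  finally show ?thesis using u by (simp add: u_def field_simps)
qed

text \<open>A form of Hoelder's inequality: bound each power by an affine function of
  \<open>a k\<close>, chosen so that the bounds add up to exactly the weighted geometric mean of the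
  two endpoint sums.\<close>

lemma ln_sum_powr_convex:
  fixes w a :: "'k \<Rightarrow> real"
  assumes K: "finite K" and w: "\<And>k. k \<in> K \<Longrightarrow> w k \<ge> 0"
    and a: "\<And>k. k \<in> K \<Longrightarrow> a k > 0"
    and pos: "(\<Sum>k\<in>K. w k) > 0" and t: "0 \<le> t" "t \<le> 1"
  shows "ln (\<Sum>k\<in>K. w k * a k powr t) \<le> (1-t) * ln (\<Sum>k\<in>K. w k) + t * ln (\<Sum>k\<in>K. w k * a k)"
proof -
  have pos': "(\<Sum>k\<in>K. w k * b k) > 0" if b: "\<And>k. k \<in> K \<Longrightarrow> b k > 0" for b
  proof -
    obtain k where "k \<in> K" "w k \<noteq> 0"
      using pos by (metis less_irrefl sum.neutral)
    thus ?thesis using w b K by (intro sum_pos2[of _ k]) (auto simp: less_le)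
  qed
  define S0 where "S0 = (\<Sum>k\<in>K. w k)"
  define S1 where "S1 = (\<Sum>k\<in>K. w k * a k)"
  \<comment> \<open>The weighted mean of the \<open>a k\<close>. The quotients
    \<open>a k / r\<close> have weighted mean 1, so the affine bounds on their powers sum to
    \<open>S0\<close>.\<close>
  define r where "r = S1 / S0"
  have S: "S0 > 0" "S1 > 0" using pos pos'[of a] a by (auto simp: S0_def S1_def)
  hence r: "r > 0" by (simp add: r_def)
  have "(\<Sum>k\<in>K. w k * a k powr t) \<le> (\<Sum>k\<in>K. w k * (r powr t * (1 - t + t * (a k / r))))"
  proof (intro sum_mono mult_left_mono w)
    fix k assume k: "k \<in> K"
    have "a k powr t = r powr t * (a k / r) powr t"
      using r a[OF k] by (simp add: powr_divide)
    also have "\<dots> \<le> r powr t * (1 - t + t * (a k / r))"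
      using r a[OF k] t by (intro mult_left_mono powr_le_affine) auto
    finally show "a k powr t \<le> r powr t * (1 - t + t * (a k / r))" .
  qed
  also have "\<dots> = (\<Sum>k\<in>K. r powr t * (1 - t) * w k + r powr t * t / r * (w k * a k))"
    by (intro sum.cong refl) (simp add: ring_distribs)
  also have "\<dots> = r powr t * (1 - t) * S0 + r powr t * t / r * S1"
    by (simp add: sum.distrib sum_distrib_left S0_def S1_def)
  also have "\<dots> = r powr t * S0"
    using S by (simp add: r_def field_simps)
  finally have le: "(\<Sum>k\<in>K. w k * a k powr t) \<le> r powr t * S0" .
  have "ln (\<Sum>k\<in>K. w k * a k powr t) \<le> ln (r powr t * S0)"
    using le by (intro ln_mono pos') (use a in force)+
  also have "\<dots> = (1 - t) * ln S0 + t * ln S1"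
    using S r by (simp add: ln_mult ln_powr r_def ln_div algebra_simps)
  finally show ?thesis by (simp add: S0_def S1_def)
qed
section \<open>Spectral theorem and functional calculus\<close>

lemma mat_adjoint_eq:
  "mat_adjoint A = mat (dim_col A) (dim_row A) (\<lambda>(i,j). cnj (A $$ (j,i)))" for A :: "complex mat"
  unfolding mat_adjoint_def by (rule eq_matI) (auto simp: mat_of_rows_index)

lemma mat_adjoint_dim [simp]:
  "dim_row (mat_adjoint A) = dim_col A" "dim_col (mat_adjoint A) = dim_row A" for A :: "complex mat"
  by (simp_all add: mat_adjoint_eq)

lemma mat_adjoint_index [simp]:
  "i < dim_col A \<Longrightarrow> j < dim_row A \<Longrightarrow> mat_adjoint A $$ (i,j) = cnj (A $$ (j,i))" for A :: "complex mat"
  by (simp add: mat_adjoint_eq)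

lemma mat_adjoint_carrier [simp]:
  "mat_adjoint A \<in> carrier_mat n m \<longleftrightarrow> A \<in> carrier_mat m n" for A :: "complex mat"
  using carrier_matI carrier_matD mat_adjoint_dim by metis

lemma mult_carrier_square [simp]:
  "A \<in> carrier_mat n n \<Longrightarrow> B \<in> carrier_mat n n \<Longrightarrow> A * B \<in> carrier_mat n n"
  by (rule mult_carrier_mat)

lemma mult_one_square [simp]:
  fixes A :: "complex mat"
  shows "A \<in> carrier_mat n n \<Longrightarrow> 1\<^sub>m n * A = A" "A \<in> carrier_mat n n \<Longrightarrow> A * 1\<^sub>m n = A"
  by (rule left_mult_one_mat right_mult_one_mat; assumption)+

lemma mat_adjoint_adjoint [simp]: "mat_adjoint (mat_adjoint A) = A" for A :: "complex mat"
  by (rule eq_matI) auto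

lemma mat_adjoint_mult:
  fixes A B :: "complex mat"
  assumes "A \<in> carrier_mat n m" "B \<in> carrier_mat m k"
  shows "mat_adjoint (A * B) = mat_adjoint B * mat_adjoint A"
  using assms by (intro eq_matI) (auto simp: scalar_prod_def mult.commute)

lemma det_mat_adjoint:
  fixes A :: "complex mat"
  assumes "A \<in> carrier_mat n n"
  shows "det (mat_adjoint A) = cnj (det A)"
  using assms
  by (subst mat_det_left_def[of _ n], simp, subst det_def'[of _ n], simp)
     (auto intro!: sum.cong prod.cong simp: permutes_in_image)

text \<open>The definition asks for a left inverse only; for square matrices a one-sided inverse is
  two-sided, which gives the last fact.\<close>

lemma unitary_matsD:
  assumes "U \<in> unitary_mats n"
  shows "U \<in> carrier_mat n n" "mat_adjoint U * U = 1\<^sub>m n" "U * mat_adjoint U = 1\<^sub>m n"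
  using assms mat_mult_left_right_inverse[of "mat_adjoint U" n U] by (auto simp: unitary_mats_def)

lemma unitary_mats_mult:
  assumes U: "U \<in> unitary_mats n" and V: "V \<in> unitary_mats n"
  shows "U * V \<in> unitary_mats n"
proof -
  note [simp] = unitary_matsD[OF U] unitary_matsD[OF V]
  have "mat_adjoint (U * V) * (U * V) = mat_adjoint V * ((mat_adjoint U * U) * V)"
    by (simp add: mat_adjoint_mult[of _ n n _ n] assoc_mult_mat[of _ n n _ n _ n] del: unitary_matsD(2)[OF U])
  also have "\<dots> = 1\<^sub>m n" by simp
  finally show ?thesis by (simp add: unitary_mats_def)
qed

section \<open>Congruences of real diagonal matrices\<close>

text \<open>\<open>C\<close> may be any matrix, so that one form covers spectral decompositions
  (\<open>C\<close> unitary) and the simultaneous diagonalisation of two positive definite matrices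
  (\<open>C\<close> invertible).\<close>

definition diag_congruence :: "nat \<Rightarrow> complex mat \<Rightarrow> (nat \<Rightarrow> real) \<Rightarrow> complex mat" where
  "diag_congruence n C d = C * mat_diag n (\<lambda>i. complex_of_real (d i)) * mat_adjoint C"

lemma diag_congruence_carrier [simp]:
  "C \<in> carrier_mat n n \<Longrightarrow> diag_congruence n C d \<in> carrier_mat n n"
  by (simp add: diag_congruence_def)

lemma diag_congruence_index:
  assumes "C \<in> carrier_mat n n" "i < n" "j < n"
  shows "diag_congruence n C d $$ (i,j) = (\<Sum>k=0..<n. C $$ (i,k) * of_real (d k) * cnj (C $$ (j,k)))"
  using assms by (simp add: diag_congruence_def mat_diag_mult_right[of _ n] scalar_prod_def)

lemma diag_congruence_cong:
  assumes "C \<in> carrier_mat n n" "\<And>i. i < n \<Longrightarrow> d i = d' i"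
  shows "diag_congruence n C d = diag_congruence n C d'"
  using assms by (intro eq_matI) (auto simp: diag_congruence_index intro!: sum.cong
     simp del: index_mult_mat simp: carrier_matD[OF diag_congruence_carrier[OF assms(1)]])

lemma diag_congruence_hermitian:
  assumes "C \<in> carrier_mat n n"
  shows "mat_adjoint (diag_congruence n C d) = diag_congruence n C d"
  by (rule eq_matI)
     (auto simp: carrier_matD[OF diag_congruence_carrier[OF assms]] diag_congruence_index[OF assms] mult_ac)

lemma diag_congruence_congruence:
  assumes "C \<in> carrier_mat n n" "P \<in> carrier_mat n n"
  shows "P * diag_congruence n C d * mat_adjoint P = diag_congruence n (P * C) d"
  using assms
  by (simp add: diag_congruence_def mat_adjoint_mult[of _ n n _ n] assoc_mult_mat[of _ n n _ n _ n])

lemma diag_congruence_one: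
  assumes "C \<in> carrier_mat n n"
  shows "diag_congruence n C (\<lambda>_. 1) = C * mat_adjoint C"
  using assms by (simp add: diag_congruence_def)

lemma diag_congruence_mult:
  assumes U: "U \<in> unitary_mats n"
  shows "diag_congruence n U d * diag_congruence n U e = diag_congruence n U (\<lambda>i. d i * e i)"
proof -
  let ?D = "\<lambda>d. mat_diag n (\<lambda>i. complex_of_real (d i))"
  note [simp] = unitary_matsD[OF U]
  have "diag_congruence n U d * diag_congruence n U e
    = U * (?D d * ((mat_adjoint U * U) * (?D e * mat_adjoint U)))"
    by (simp add: diag_congruence_def assoc_mult_mat[of _ n n _ n _ n] del: unitary_matsD(2)[OF U])
  also have "\<dots> = U * ((?D d * ?D e) * mat_adjoint U)"
    by (simp add: assoc_mult_mat[of _ n n _ n _ n] del: mat_diag_diag)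
  also have "\<dots> = diag_congruence n U (\<lambda>i. d i * e i)"
    by (simp add: diag_congruence_def assoc_mult_mat[of _ n n _ n _ n])
  finally show ?thesis .
qed

lemma det_diag_congruence:
  assumes "C \<in> carrier_mat n n"
  shows "det (diag_congruence n C d) = of_real ((cmod (det C))\<^sup>2 * (\<Prod>i=0..<n. d i))"
proof -
  have "diag_mat (mat_diag n (\<lambda>i. complex_of_real (d i))) = map (\<lambda>i. complex_of_real (d i)) [0..<n]"
    by (auto simp: mat_diag_def diag_mat_def)
  hence "det (mat_diag n (\<lambda>i. complex_of_real (d i))) = of_real (\<Prod>i=0..<n. d i)"
    using prod.distinct_set_conv_list[of "[0..<n]" "\<lambda>i. complex_of_real (d i)"]
    by (subst det_upper_triangular[of _ n]) (auto simp: mat_diag_def upper_triangular_def)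
  thus ?thesis using assms
    by (simp add: diag_congruence_def det_mult[of _ n] det_mat_adjoint del: of_real_power of_real_prod) (simp add: complex_norm_square del: of_real_power of_real_prod)
qed

section \<open>The spectral theorem\<close>

text \<open>Extend \<open>v\<close> to a basis and apply Gram-Schmidt, which keeps the first vector;
  then normalise. The scalar \<open>c\<close> is the reciprocal of the norm of
  \<open>v\<close>.\<close>

lemma unitary_completion:
  fixes v :: "complex vec"
  assumes v: "v \<in> carrier_vec n" and v0: "v \<noteq> 0\<^sub>v n"
  obtains U c where "U \<in> unitary_mats n" "col U 0 = c \<cdot>\<^sub>v v"
proof -
  interpret cof_vec_space n "TYPE(complex)" .
  define b where "b = basis_completion v"
  define ws where "ws = gram_schmidt n b"
  from basis_completion[OF v v0, folded b_def]
  have dist_b: "distinct b" and indep: "\<not> lin_dep (set b)" and b: "set b \<subseteq> carrier_vec n"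
    and hdb: "hd b = v" and len_b: "length b = n" by auto
  have n: "n > 0" using v v0 by (cases n) auto
  with hdb len_b obtain vs where bv: "b = v # vs" by (cases b) auto
  from gram_schmidt_result[OF b dist_b indep refl, folded ws_def]
  have ws: "set ws \<subseteq> carrier_vec n" "corthogonal ws" "length ws = n"
    by (auto simp: len_b)
  have "hd ws = v" using gram_schmidt_hd[OF v, of vs, folded bv] by (simp add: ws_def)
  hence ws0: "ws ! 0 = v" using ws(3) n by (cases ws) auto
  have wsi: "ws ! i \<in> carrier_vec n" if "i < n" for i using ws that by auto
  \<comment> \<open>The norm of the vector \<open>ws ! j\<close>: \<open>corthogonal\<close> gives
    orthogonality and nonzero norms, but not unit norms.\<close>
  define r where "r j = complex_of_real (sqrt (Re (ws ! j \<bullet>c ws ! j)))" for j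
  have r: "r j * cnj (r j) = ws ! j \<bullet>c ws ! j" "r j \<noteq> 0" if j: "j < n" for j
  proof -
    have ge: "ws ! j \<bullet>c ws ! j \<ge> 0" by (rule conjugate_square_ge_0_vec)
    have "ws ! j \<bullet>c ws ! j \<noteq> 0" using corthogonalD[OF ws(2), of j j] j ws(3) by simp
    with ge show "r j * cnj (r j) = ws ! j \<bullet>c ws ! j" "r j \<noteq> 0"
      by (auto simp: r_def less_eq_complex_def complex_eq_iff simp flip: of_real_mult)
  qed
  define U where "U = mat n n (\<lambda>(i,j). ws ! j $ i / r j)"
  have U: "U \<in> carrier_mat n n" by (simp add: U_def)
  have "mat_adjoint U * U = 1\<^sub>m n"
  proof (rule eq_matI)
    fix i j assume "i < dim_row (1\<^sub>m n :: complex mat)" "j < dim_col (1\<^sub>m n :: complex mat)"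
    hence ij: "i < n" "j < n" by auto
    have "(mat_adjoint U * U) $$ (i,j) = (\<Sum>k=0..<n. cnj (ws ! i $ k / r i) * (ws ! j $ k / r j))"
      using ij U by (simp add: scalar_prod_def U_def)
    also have "\<dots> = (ws ! j \<bullet>c ws ! i) / (r j * cnj (r i))"
      using wsi[OF ij(1)] wsi[OF ij(2)] by (simp add: scalar_prod_def sum_divide_distrib mult_ac)
    also have "\<dots> = 1\<^sub>m n $$ (i,j)"
      using r[OF ij(1)] corthogonalD[OF ws(2), of j i] ij ws(3) by (cases "i = j") auto
    finally show "(mat_adjoint U * U) $$ (i,j) = 1\<^sub>m n $$ (i,j)" .
  qed (use U in auto)
  moreover have "col U 0 = (1 / r 0) \<cdot>\<^sub>v v"
    using n v by (intro eq_vecI) (auto simp: U_def ws0)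
  ultimately show ?thesis using that[of U "1 / r 0"] U by (simp add: unitary_mats_def)
qed

text \<open>Deflation, by induction on \<open>n\<close>: a unitary change of basis puts an
  eigenvector first, Hermitian symmetry then clears the first row along with the first column, and
  the remaining block is smaller.\<close>

theorem hermitian_spectral_decomposition:
  fixes A :: "complex mat"
  assumes "A \<in> carrier_mat n n" "mat_adjoint A = A"
  obtains U d where "U \<in> unitary_mats n" "A = diag_congruence n U d"
proof -
  have "\<exists>U\<in>unitary_mats n. \<exists>d. A = diag_congruence n U d"
    using assms
  proof (induction n arbitrary: A)
    case 0
    show ?case
      by (rule bexI[of _ "1\<^sub>m 0"], rule exI[of _ "\<lambda>_. 0"], intro eq_matI)
         (use 0 in \<open>auto simp: unitary_mats_def diag_congruence_def mat_diag_def intro!: eq_matI\<close>)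
  next
    case (Suc n A)
    let ?N = "Suc n"
    note A = Suc.prems(1) and herm = Suc.prems(2)
    obtain e where "eigenvalue A e"
      using spectrum_non_empty[OF A] by (auto simp: spectrum_def)
    then obtain v where v: "v \<in> carrier_vec ?N" "v \<noteq> 0\<^sub>v ?N" "A *\<^sub>v v = e \<cdot>\<^sub>v v"
      using A by (auto simp: eigenvalue_def eigenvector_def)
    obtain U c where U: "U \<in> unitary_mats ?N" and U0: "col U 0 = c \<cdot>\<^sub>v v"
      using unitary_completion[OF v(1,2)] by blast
    note Uc = unitary_matsD(1)[OF U] and UU = unitary_matsD(2,3)[OF U]
    define B where "B = mat_adjoint U * A * U"
    have B: "B \<in> carrier_mat ?N ?N" using A Uc by (simp add: B_def)
    have B_herm: "mat_adjoint B = B"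
      using A Uc herm
      by (simp add: B_def mat_adjoint_mult[of _ ?N ?N _ ?N] assoc_mult_mat[of _ ?N ?N _ ?N _ ?N])
    have A_eq: "A = U * B * mat_adjoint U"
    proof -
      have "U * B * mat_adjoint U = (U * mat_adjoint U) * (A * (U * mat_adjoint U))"
        using A Uc by (simp add: B_def assoc_mult_mat[of _ ?N ?N _ ?N _ ?N])
      thus ?thesis using A by (simp add: UU)
    qed
    \<comment> \<open>The first column of \<open>U\<close> is a multiple of \<open>v\<close>, hence
      is scaled by \<open>e\<close> under \<open>A\<close>. The first column of \<open>B\<close> is
      therefore \<open>e\<close> times that of the identity.\<close>
    have B0: "B $$ (i,0) = (if i = 0 then e else 0)" if i: "i < ?N" for i
    proof -
      have "B = mat_adjoint U * (A * U)"
        using A Uc by (simp add: B_def assoc_mult_mat[of _ ?N ?N _ ?N _ ?N])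
      hence "B $$ (i,0) = row (mat_adjoint U) i \<bullet> col (A * U) 0"
        using A Uc i by simp
      also have "col (A * U) 0 = A *\<^sub>v col U 0"
        using A Uc by (intro col_mult2) auto
      also have "\<dots> = e \<cdot>\<^sub>v col U 0"
        using A v by (simp add: U0 mult_mat_vec smult_smult_assoc mult.commute)
      also have "row (mat_adjoint U) i \<bullet> (e \<cdot>\<^sub>v col U 0) = e * (mat_adjoint U * U) $$ (i,0)"
        using Uc i by (simp add: scalar_prod_smult_right)
      also have "\<dots> = (if i = 0 then e else 0)" using i by (simp add: UU)
      finally show ?thesis .
    qed
    have B_cnj: "B $$ (i,j) = cnj (B $$ (j,i))" if "i < ?N" "j < ?N" for i j
      using arg_cong[OF B_herm, of "\<lambda>M. M $$ (i,j)"] that B by simp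
    \<comment> \<open>The corner entry of a Hermitian matrix is its own conjugate, so the eigenvalue
      is real and can be an entry of \<open>d'\<close>.\<close>
    have e: "e = of_real (Re e)"
      using B_cnj[of 0 0] B0[of 0] by (simp add: complex_eq_iff)
    define B' where "B' = mat n n (\<lambda>(i,j). B $$ (Suc i, Suc j))"
    have B': "B' \<in> carrier_mat n n" by (simp add: B'_def)
    moreover have "mat_adjoint B' = B'"
      by (rule eq_matI) (auto simp: B'_def B_cnj[symmetric])
    ultimately obtain V d where V: "V \<in> unitary_mats n" and Vd: "B' = diag_congruence n V d"
      using Suc.IH by blast
    note Vc = unitary_matsD(1)[OF V]
    \<comment> \<open>The block diagonal matrix with blocks 1 and \<open>V\<close>; correspondingly
      \<open>d'\<close> puts the eigenvalue in front of \<open>d\<close>.\<close>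
    define V' where "V' = mat ?N ?N (\<lambda>(i,j). if i = 0 \<or> j = 0 then (if i = j then 1 else 0) else V $$ (i - 1, j - 1))"
    define d' where "d' = case_nat (Re e) d"
    have V': "V' \<in> carrier_mat ?N ?N" by (simp add: V'_def)
    have "mat_adjoint V' * V' = 1\<^sub>m ?N"
    proof (rule eq_matI)
      fix i j assume "i < dim_row (1\<^sub>m ?N :: complex mat)" "j < dim_col (1\<^sub>m ?N :: complex mat)"
      hence ij: "i < ?N" "j < ?N" by auto
      have *: "(\<Sum>k=0..<n. cnj (V $$ (k,i)) * V $$ (k,j)) = (if i = j then 1 else 0)"
        if "i < n" "j < n" for i j
        using arg_cong[OF unitary_matsD(2)[OF V], of "\<lambda>M. M $$ (i,j)"] that Vc
        by (simp add: scalar_prod_def)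
      have "(mat_adjoint V' * V') $$ (i,j) = (\<Sum>k=0..<?N. cnj (V' $$ (k,i)) * V' $$ (k,j))"
        using ij V' by (simp add: scalar_prod_def del: sum.op_ivl_Suc)
      also have "\<dots> = 1\<^sub>m ?N $$ (i,j)"
        using ij * by (cases i; cases j) (auto simp: sum.atLeast0_lessThan_Suc_shift V'_def simp del: sum.op_ivl_Suc)
      finally show "(mat_adjoint V' * V') $$ (i,j) = 1\<^sub>m ?N $$ (i,j)" .
    qed (use V' in auto)
    hence V'u: "V' \<in> unitary_mats ?N" using V' by (simp add: unitary_mats_def)
    have "B = diag_congruence ?N V' d'"
    proof (rule eq_matI)
      fix i j assume "i < dim_row (diag_congruence ?N V' d')" "j < dim_col (diag_congruence ?N V' d')"
      hence ij: "i < ?N" "j < ?N" using carrier_matD[OF diag_congruence_carrier[OF V', of d']] by auto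
      have *: "B $$ (Suc i, Suc j) = (\<Sum>k=0..<n. V $$ (i,k) * of_real (d k) * cnj (V $$ (j,k)))"
        if "i < n" "j < n" for i j
        using arg_cong[OF Vd, of "\<lambda>M. M $$ (i,j)"] that diag_congruence_index[OF Vc]
        by (simp add: B'_def)
      have B0j: "B $$ (0, Suc j) = 0" if "j < n" for j using B_cnj[of 0 "Suc j"] B0[of "Suc j"] that by simp
      have "diag_congruence ?N V' d' $$ (i,j) = (\<Sum>k=0..<?N. V' $$ (i,k) * of_real (d' k) * cnj (V' $$ (j,k)))"
        by (rule diag_congruence_index[OF V' ij])
      also have "\<dots> = B $$ (i,j)"
        using ij * B0 B0j e
        by (cases i; cases j)
           (auto simp: sum.atLeast0_lessThan_Suc_shift V'_def d'_def simp del: sum.op_ivl_Suc)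
      finally show "B $$ (i,j) = diag_congruence ?N V' d' $$ (i,j)" by simp
    qed (use B V' in \<open>auto simp: carrier_matD[OF diag_congruence_carrier[OF V']]\<close>)
    hence "A = diag_congruence ?N (U * V') d'"
      using A_eq diag_congruence_congruence[OF V' Uc] by simp
    thus ?case using unitary_mats_mult[OF U V'u] by blast
  qed
  thus ?thesis using that by blast
qed

section \<open>Functional calculus and real powers\<close>

text \<open>The point is that the definite description is proper: two diagonalisations of one matrix
  must give the same value. The transition matrix \<open>W\<close> intertwines the two diagonals,
  hence also their images under \<open>f\<close>.\<close>

lemma herm_fun_diag_congruence:
  assumes U: "U \<in> unitary_mats n"
  shows "herm_fun f (diag_congruence n U d) = diag_congruence n U (\<lambda>i. f (d i))"
proof -
  let ?D = "\<lambda>d. mat_diag n (\<lambda>i. complex_of_real (d i))"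
  note Uc = unitary_matsD(1)[OF U]
  have dim: "dim_row (diag_congruence n U d) = n"
    using diag_congruence_carrier[OF Uc] by (rule carrier_matD)
  have unique: "diag_congruence n V (\<lambda>i. f (e i)) = diag_congruence n U (\<lambda>i. f (d i))"
    if V: "V \<in> unitary_mats n" and eq: "diag_congruence n U d = diag_congruence n V e" for V e
  proof -
    note Vc = unitary_matsD(1)[OF V]
    note [simp] = Uc Vc
    note assoc = assoc_mult_mat[of _ n n _ n _ n]
    define W where "W = mat_adjoint V * U"
    have W: "W \<in> carrier_mat n n" by (simp add: W_def)
    have VW: "V * W = U"
      by (simp add: W_def assoc_mult_mat[of V n n "mat_adjoint V" n U n, symmetric] unitary_matsD[OF V])
    have WU: "W * mat_adjoint U = mat_adjoint V"
      by (simp add: W_def assoc unitary_matsD[OF U])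
    have "W * ?D d = mat_adjoint V * (diag_congruence n U d * U)"
      by (simp add: W_def diag_congruence_def assoc unitary_matsD[OF U])
    also have "\<dots> = (mat_adjoint V * V) * (?D e * (mat_adjoint V * U))"
      unfolding eq by (simp add: diag_congruence_def assoc)
    also have "\<dots> = ?D e * W"
      by (simp add: unitary_matsD[OF V] W_def)
    finally have comm: "W * ?D d = ?D e * W" .
    have comm': "W * ?D (\<lambda>i. f (d i)) = ?D (\<lambda>i. f (e i)) * W"
    proof (rule eq_matI)
      fix i j assume "i < dim_row (?D (\<lambda>i. f (e i)) * W)" "j < dim_col (?D (\<lambda>i. f (e i)) * W)"
      hence ij: "i < n" "j < n" using W by (auto simp: mat_diag_def)
      from arg_cong[OF comm, of "\<lambda>M. M $$ (i,j)"]
      have "W $$ (i,j) * of_real (d j) = of_real (e i) * W $$ (i,j)"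
        using ij W by (simp add: mat_diag_mult_left[of _ n n] mat_diag_mult_right[of _ n n])
      \<comment> \<open>A nonzero entry of \<open>W\<close> links equal eigenvalues only, and
        \<open>f\<close> agrees on those.\<close>
      hence "W $$ (i,j) = 0 \<or> d j = e i" by auto
      thus "(W * ?D (\<lambda>i. f (d i))) $$ (i,j) = (?D (\<lambda>i. f (e i)) * W) $$ (i,j)"
        using ij W by (auto simp: mat_diag_mult_left[of _ n n] mat_diag_mult_right[of _ n n])
    qed (use W in \<open>auto simp: mat_diag_def\<close>)
    have "diag_congruence n V (\<lambda>i. f (e i)) = V * ((?D (\<lambda>i. f (e i)) * W) * mat_adjoint U)"
      using W by (simp add: diag_congruence_def assoc WU)
    also have "\<dots> = (V * W) * (?D (\<lambda>i. f (d i)) * mat_adjoint U)"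
      using W by (simp add: assoc flip: comm')
    also have "\<dots> = diag_congruence n U (\<lambda>i. f (d i))"
      unfolding VW by (simp add: diag_congruence_def assoc)
    finally show ?thesis .
  qed
  show ?thesis
    unfolding herm_fun_def dim diag_congruence_def[symmetric]
  proof (rule the_equality)
    show "\<exists>V\<in>unitary_mats n. \<exists>e. diag_congruence n U d = diag_congruence n V e \<and>
      diag_congruence n U (\<lambda>i. f (d i)) = diag_congruence n V (\<lambda>i. f (e i))"
      using U by blast
  next
    fix F
    assume "\<exists>V\<in>unitary_mats n. \<exists>e. diag_congruence n U d = diag_congruence n V e \<and>
      F = diag_congruence n V (\<lambda>i. f (e i))"
    then obtain V e where "V \<in> unitary_mats n" "diag_congruence n U d = diag_congruence n V e"
      and F: "F = diag_congruence n V (\<lambda>i. f (e i))" by (elim bexE exE conjE)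
    thus "F = diag_congruence n U (\<lambda>i. f (d i))"
      unfolding F by (intro unique)
  qed
qed

lemma mat_powr_diag_congruence:
  assumes "U \<in> unitary_mats n"
  shows "mat_powr (diag_congruence n U d) p = diag_congruence n U (\<lambda>i. d i powr p)"
  unfolding mat_powr_def by (rule herm_fun_diag_congruence[OF assms])

section \<open>Geodesics\<close>

lemma hpd_matsD:
  assumes "A \<in> hpd_mats n"
  shows "A \<in> carrier_mat n n" "mat_adjoint A = A"
    "\<And>v. v \<in> carrier_vec n \<Longrightarrow> v \<noteq> 0\<^sub>v n \<Longrightarrow> Re ((A *\<^sub>v v) \<bullet>c v) > 0"
  using assms by (auto simp: hpd_mats_def)

lemma hpd_mats_add:
  assumes A: "A \<in> hpd_mats n" and B: "B \<in> hpd_mats n"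
  shows "A + B \<in> hpd_mats n"
proof -
  note [simp] = hpd_matsD(1)[OF A] hpd_matsD(1)[OF B]
  have "mat_adjoint (A + B) = mat_adjoint A + mat_adjoint B"
    by (rule eq_matI) (auto simp: carrier_matD[OF hpd_matsD(1)[OF A]] carrier_matD[OF hpd_matsD(1)[OF B]])
  moreover have "Re (((A + B) *\<^sub>v v) \<bullet>c v) > 0" if v: "v \<in> carrier_vec n" "v \<noteq> 0\<^sub>v n" for v
  proof -
    have "((A + B) *\<^sub>v v) \<bullet>c v = (A *\<^sub>v v) \<bullet>c v + (B *\<^sub>v v) \<bullet>c v"
      using v by (simp add: add_mult_distrib_mat_vec[of _ n n] mult_mat_vec_carrier[of _ n n] add_scalar_prod_distrib[of _ n])
    thus ?thesis using hpd_matsD(3)[OF A v] hpd_matsD(3)[OF B v] by simp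
  qed
  ultimately show ?thesis using hpd_matsD(2)[OF A] hpd_matsD(2)[OF B] by (simp add: hpd_mats_def)
qed

text \<open>The diagonal entry is the quadratic form of \<open>A\<close> at column \<open>i\<close>
  of \<open>C\<close>, and the left inverse \<open>R\<close> keeps that column from being
  zero.\<close>

lemma hpd_congruence_diag_pos:
  assumes A: "A \<in> hpd_mats n" and C: "C \<in> carrier_mat n n" and R: "R \<in> carrier_mat n n" "R * C = 1\<^sub>m n"
    and i: "i < n"
  shows "Re ((mat_adjoint C * A * C) $$ (i,i)) > 0"
proof -
  note Ac = hpd_matsD(1)[OF A]
  define v where "v = col C i"
  have v: "v \<in> carrier_vec n" using C i by (auto simp: v_def)
  have "v \<noteq> 0\<^sub>v n"
  proof
    assume "v = 0\<^sub>v n"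
    hence "(R * C) $$ (i,i) = 0" using C R(1) i by (simp add: v_def)
    thus False using i by (simp add: R)
  qed
  hence "Re ((A *\<^sub>v v) \<bullet>c v) > 0" using hpd_matsD(3)[OF A v] by simp
  moreover have "(mat_adjoint C * A * C) $$ (i,i) = (A *\<^sub>v v) \<bullet>c v"
  proof -
    have row: "row (mat_adjoint C) i = conjugate v"
      using C i by (intro eq_vecI) (auto simp: v_def)
    have "mat_adjoint C * A * C = mat_adjoint C * (A * C)"
      using Ac C by (simp add: assoc_mult_mat[of _ n n _ n _ n])
    hence "(mat_adjoint C * A * C) $$ (i,i) = row (mat_adjoint C) i \<bullet> col (A * C) i"
      using Ac C i by simp
    also have "col (A * C) i = A *\<^sub>v v"
      unfolding v_def by (rule col_mult2[OF Ac C i])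
    also have "row (mat_adjoint C) i \<bullet> (A *\<^sub>v v) = (A *\<^sub>v v) \<bullet>c v"
      unfolding row using Ac v by (intro comm_scalar_prod[of _ n]) auto
    finally show ?thesis .
  qed
  ultimately show ?thesis by simp
qed

text \<open>The \<open>d i\<close> are the diagonal entries of the congruence of \<open>A\<close> by
  \<open>P * U\<close>, which has the left inverse \<open>mat_adjoint U * Q\<close>; hence they are
  positive. The identity as \<open>P\<close> gives the spectral theorem for \<open>A\<close>
  itself.\<close>

lemma hpd_congruence_spectral:
  assumes A: "A \<in> hpd_mats n" and P: "P \<in> carrier_mat n n" and Q: "Q \<in> carrier_mat n n" "Q * P = 1\<^sub>m n"
  obtains U d where "U \<in> unitary_mats n" "\<And>i. i < n \<Longrightarrow> d i > 0" "mat_adjoint P * A * P = diag_congruence n U d"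
proof -
  note [simp] = hpd_matsD(1,2)[OF A] P Q
  note assoc = assoc_mult_mat[of _ n n _ n _ n]
  have "mat_adjoint (mat_adjoint P * A * P) = mat_adjoint P * A * P"
    by (simp add: mat_adjoint_mult[of _ n n _ n] assoc)
  then obtain U d where U: "U \<in> unitary_mats n" and eq: "mat_adjoint P * A * P = diag_congruence n U d"
    using hermitian_spectral_decomposition[of "mat_adjoint P * A * P" n] by auto
  note [simp] = unitary_matsD(1)[OF U]
  let ?D = "mat_diag n (\<lambda>i. complex_of_real (d i))"
  have "mat_adjoint (P * U) * A * (P * U) = mat_adjoint U * (mat_adjoint P * A * P) * U"
    by (simp add: mat_adjoint_mult[of _ n n _ n] assoc)
  also have "\<dots> = (mat_adjoint U * U) * (?D * (mat_adjoint U * U))"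
    unfolding eq by (simp add: diag_congruence_def assoc)
  also have "\<dots> = ?D" by (simp add: unitary_matsD[OF U])
  finally have D: "mat_adjoint (P * U) * A * (P * U) = ?D" .
  have "(mat_adjoint U * Q) * (P * U) = mat_adjoint U * ((Q * P) * U)"
    by (simp add: assoc del: Q(2))
  hence inv: "(mat_adjoint U * Q) * (P * U) = 1\<^sub>m n" by (simp add: unitary_matsD[OF U])
  have "d i > 0" if i: "i < n" for i
    using hpd_congruence_diag_pos[OF A _ _ inv i] i by (simp add: D) (simp add: mat_diag_def)
  thus ?thesis using that U eq by blast
qed

text \<open>Here \<open>C = X^(1/2) V\<close>, where \<open>V\<close> diagonalises \<open>X^(-1/2) Y X^(-1/2)\<close>.\<close>

lemma geodesic_point_diag_congruence:
  assumes X: "X \<in> hpd_mats n" and Y: "Y \<in> hpd_mats n"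
  obtains C e where "C \<in> carrier_mat n n" "det C \<noteq> 0" "\<And>i. i < n \<Longrightarrow> e i > 0"
    "\<And>t. (X \<sharp>\<^bsub>t\<^esub> Y) = diag_congruence n C (\<lambda>i. e i powr t)"
    "X = diag_congruence n C (\<lambda>_. 1)" "Y = diag_congruence n C e"
proof -
  note [simp] = hpd_matsD(1)[OF X] hpd_matsD(1)[OF Y]
  note assoc = assoc_mult_mat[of _ n n _ n _ n]
  obtain U d where U: "U \<in> unitary_mats n" and d: "\<And>i. i < n \<Longrightarrow> d i > 0"
    and X_eq: "X = diag_congruence n U d"
  proof (rule hpd_congruence_spectral[OF X, of "1\<^sub>m n" "1\<^sub>m n"])
    have "mat_adjoint (1\<^sub>m n) = (1\<^sub>m n :: complex mat)" by (rule eq_matI) auto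
    hence X: "mat_adjoint (1\<^sub>m n) * X * 1\<^sub>m n = X" by simp
    note result = that
    show thesis if "U \<in> unitary_mats n" "\<And>i. i < n \<Longrightarrow> d i > 0"
      "mat_adjoint (1\<^sub>m n) * X * 1\<^sub>m n = diag_congruence n U d" for U d
      by (rule result[OF that(1,2) that(3)[unfolded X]])
  qed auto
  note [simp] = unitary_matsD(1)[OF U]
  define S where "S = mat_powr X (1/2)"
  define R where "R = mat_powr X (-1/2)"
  have S_eq: "S = diag_congruence n U (\<lambda>i. d i powr (1/2))" and R_eq: "R = diag_congruence n U (\<lambda>i. d i powr (-1/2))"
    by (simp_all only: S_def R_def X_eq mat_powr_diag_congruence[OF U])
  have S [simp]: "S \<in> carrier_mat n n" "mat_adjoint S = S" and R [simp]: "R \<in> carrier_mat n n" "mat_adjoint R = R"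
    by (simp_all add: S_eq R_eq diag_congruence_hermitian)
  have SS: "S * S = X"
    unfolding S_eq X_eq diag_congruence_mult[OF U]
    by (intro diag_congruence_cong) (auto simp: powr_add[symmetric] less_imp_le d)
  \<comment> \<open>Positivity of \<open>d i\<close> matters here: the exponents add up to 0, and
    \<open>0 powr 0\<close> is 0 rather than 1.\<close>
  have "S * R = diag_congruence n U (\<lambda>_. 1)"
    unfolding S_eq R_eq diag_congruence_mult[OF U]
    by (intro diag_congruence_cong) (auto simp: powr_add[symmetric] dest: d)
  hence SR: "S * R = 1\<^sub>m n" by (simp add: diag_congruence_one unitary_matsD[OF U])
  hence RS: "R * S = 1\<^sub>m n" using mat_mult_left_right_inverse[of S n R] by simp
  \<comment> \<open>Since \<open>R\<close> is Hermitian, \<open>R * Y * R\<close> is a congruence of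
    \<open>Y\<close>, with \<open>S\<close> as the inverse of \<open>R\<close>. The
    \<open>e i\<close> are the ratios by which the geodesic moves from \<open>X\<close> to
    \<open>Y\<close>.\<close>
  obtain V e where V: "V \<in> unitary_mats n" and e: "\<And>i. i < n \<Longrightarrow> e i > 0" and M: "R * Y * R = diag_congruence n V e"
    using hpd_congruence_spectral[OF Y R(1) S(1) SR] by auto
  note [simp] = unitary_matsD(1)[OF V]
  define C where "C = S * V"
  have C: "C \<in> carrier_mat n n" by (simp add: C_def)
  have "(mat_adjoint V * R) * C = mat_adjoint V * ((R * S) * V)" by (simp add: C_def assoc)
  also have "\<dots> = 1\<^sub>m n" by (simp add: RS unitary_matsD[OF V])
  finally have "det (mat_adjoint V * R) * det C = 1" using C by (simp flip: det_mult[of _ n])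
  hence "det C \<noteq> 0" by auto
  moreover have "(X \<sharp>\<^bsub>t\<^esub> Y) = diag_congruence n C (\<lambda>i. e i powr t)" for t
    unfolding geodesic_point_def S_def[symmetric] R_def[symmetric] M mat_powr_diag_congruence[OF V] C_def
    using diag_congruence_congruence[of V n S] by simp
  moreover have "X = diag_congruence n C (\<lambda>_. 1)"
  proof -
    have "C * mat_adjoint C = S * ((V * mat_adjoint V) * S)"
      by (simp add: C_def mat_adjoint_mult[of _ n n _ n] assoc)
    thus ?thesis by (simp add: diag_congruence_one[OF C] unitary_matsD[OF V] SS)
  qed
  moreover have "Y = diag_congruence n C e"
  proof -
    have "diag_congruence n C e = S * (R * Y * R) * S"
      using diag_congruence_congruence[of V n S e] by (simp add: M C_def)
    also have "\<dots> = (S * R) * (Y * (R * S))" by (simp add: assoc)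
    also have "\<dots> = Y" by (simp add: SR RS)
    finally show ?thesis by simp
  qed
  ultimately show ?thesis using that C e by blast
qed

text \<open>The degenerate geodesic from \<open>X\<close> to itself supplies an invertible
  \<open>C\<close> with \<open>X = C * mat_adjoint C\<close>, whose determinant is the squared
  modulus of \<open>det C\<close>.\<close>

lemma hpd_det_pos:
  assumes X: "X \<in> hpd_mats n"
  shows "Re (det X) > 0"
proof -
  obtain C where "C \<in> carrier_mat n n" "det C \<noteq> 0" "X = diag_congruence n C (\<lambda>_. 1)"
    by (rule geodesic_point_diag_congruence[OF X X]) blast
  thus ?thesis using det_diag_congruence[of C n "\<lambda>_. 1"] by simp
qed

section \<open>Convexity of the midpoint term and conclusion\<close>

text \<open>Cauchy-Binet writes \<open>L p q\<close> with weights \<open>w g\<close> independent of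
  \<open>p\<close> and \<open>q\<close>, so raising all entries to the power \<open>t\<close> only
  raises each \<open>a g\<close> to that power. The assumption \<open>pos\<close> says that the
  weights do not all vanish.\<close>

lemma ln_det_midpoint_convex:
  assumes C: "C \<in> carrier_mat n n" and C': "C' \<in> carrier_mat n n"
    and e: "\<And>i. i < n \<Longrightarrow> e i > 0" and e': "\<And>i. i < n \<Longrightarrow> e' i > 0"
    and t: "0 \<le> t" "t \<le> 1"
  defines "L \<equiv> \<lambda>p q. Re (det ((1/2) \<cdot>\<^sub>m (diag_congruence n C p + diag_congruence n C' q)))"
  assumes pos: "L (\<lambda>_. 1) (\<lambda>_. 1) > 0"
  shows "ln (L (\<lambda>i. e i powr t) (\<lambda>i. e' i powr t)) \<le> (1 - t) * ln (L (\<lambda>_. 1) (\<lambda>_. 1)) + t * ln (L e e')"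
proof -
  \<comment> \<open>The disjoint sum indexes the \<open>2 * n\<close> columns of \<open>C\<close>
    and \<open>C'\<close> placed side by side.\<close>
  define K :: "(nat + nat) set" where "K = {0..<n} <+> {0..<n}"
  define c where "c i = case_sum (\<lambda>k. C $$ (i,k)) (\<lambda>k. C' $$ (i,k))" for i
  \<comment> \<open>The factor \<open>(1/2)^n\<close> comes from halving an \<open>n\<close> by
    \<open>n\<close> matrix, and \<open>fact n\<close> from summing over maps instead of
    subsets.\<close>
  define w where "w g = (1/2)^n * (cmod (det (mat n n (\<lambda>(i,j). c i (g j)))))\<^sup>2 / fact n" for g
  define a where "a g = (\<Prod>i=0..<n. case_sum e e' (g i))" for g
  let ?G = "{0..<n} \<rightarrow>\<^sub>E K"
  have K: "finite K" by (simp add: K_def)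
  have L: "L p q = (\<Sum>g\<in>?G. w g * (\<Prod>i=0..<n. case_sum p q (g i)))" for p q
  proof -
    let ?M = "mat n n (\<lambda>(i,j). \<Sum>k\<in>K. c i k * of_real (case_sum p q k) * cnj (c j k))"
    have "diag_congruence n C p + diag_congruence n C' q = ?M"
      using carrier_matD[OF diag_congruence_carrier[OF C]] carrier_matD[OF diag_congruence_carrier[OF C']]
      by (intro eq_matI)
         (auto simp: diag_congruence_index[OF C] diag_congruence_index[OF C'] K_def c_def sum.Plus)
    hence "L p q = Re (of_real ((1/2)^n) * det ?M)"
      by (simp add: L_def carrier_matD[OF diag_congruence_carrier[OF C']])
    also have "det ?M = fact n * det ?M / fact n" by simp
    also have "\<dots> = of_real (\<Sum>g\<in>?G. (cmod (det (mat n n (\<lambda>(i,j). c i (g j)))))\<^sup>2 * (\<Prod>i=0..<n. case_sum p q (g i))) / of_real (fact n)"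
      unfolding det_weighted_gram[OF K] of_real_sum of_real_fact ..
    also have "Re (of_real ((1/2)^n) * \<dots>) = (\<Sum>g\<in>?G. w g * (\<Prod>i=0..<n. case_sum p q (g i)))"
      by (simp only: Re_complex_of_real flip: of_real_divide of_real_mult)
         (simp add: w_def sum_distrib_left sum_divide_distrib mult.assoc)
    finally show ?thesis .
  qed
  have e_pos: "case_sum e e' (g i) > 0" if "g \<in> ?G" "i < n" for g i
  proof -
    have "g i \<in> K" using that by (auto simp: PiE_iff)
    thus ?thesis using e e' by (auto simp: K_def)
  qed
  have L1: "L (\<lambda>_. 1) (\<lambda>_. 1) = (\<Sum>g\<in>?G. w g)"
    unfolding L by (intro sum.cong refl) (simp add: prod.neutral split: sum.split)
  have Le: "L e e' = (\<Sum>g\<in>?G. w g * a g)"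
    by (simp add: L a_def)
  have Lt: "L (\<lambda>i. e i powr t) (\<lambda>i. e' i powr t) = (\<Sum>g\<in>?G. w g * a g powr t)"
  proof (unfold L, rule sum.cong[OF refl])
    fix g
    have "(\<Prod>i=0..<n. case_sum (\<lambda>i. e i powr t) (\<lambda>i. e' i powr t) (g i)) = (\<Prod>i=0..<n. case_sum e e' (g i) powr t)"
      by (intro prod.cong refl) (simp split: sum.split)
    also have "\<dots> = a g powr t"
      unfolding a_def by (rule prod_powr_distrib[symmetric])
    finally show "w g * (\<Prod>i=0..<n. case_sum (\<lambda>i. e i powr t) (\<lambda>i. e' i powr t) (g i)) = w g * a g powr t" by simp
  qed
  show ?thesis
    unfolding Lt Le L1
  proof (rule ln_sum_powr_convex)
    show "finite ?G" using K by (intro finite_PiE) auto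
    show "a g > 0" if "g \<in> ?G" for g
      unfolding a_def by (intro prod_pos) (auto intro: e_pos[OF that])
    show "(\<Sum>g\<in>?G. w g) > 0" using pos unfolding L1 .
  qed (use t in \<open>auto simp: w_def\<close>)
qed

theorem theorem4p4:
  fixes n :: nat and X1 X2 Y1 Y2 :: "complex mat" and t :: real
  assumes "X1 \<in> hpd_mats n" and "X2 \<in> hpd_mats n"
    and "Y1 \<in> hpd_mats n" and "Y2 \<in> hpd_mats n"
    and "0 \<le> t" and "t \<le> 1"
  shows "delta_S_sq (X1 \<sharp>\<^bsub>t\<^esub> X2) (Y1 \<sharp>\<^bsub>t\<^esub> Y2)
    \<le> (1 - t) * delta_S_sq X1 Y1 + t * delta_S_sq X2 Y2"
proof -
  obtain C e where C: "C \<in> carrier_mat n n" "det C \<noteq> 0" and e: "\<And>i. i < n \<Longrightarrow> e i > 0"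
    and X: "\<And>t. (X1 \<sharp>\<^bsub>t\<^esub> X2) = diag_congruence n C (\<lambda>i. e i powr t)"
    and X1: "X1 = diag_congruence n C (\<lambda>_. 1)" and X2: "X2 = diag_congruence n C e"
    using geodesic_point_diag_congruence[OF assms(1,2)] by blast
  obtain C' e' where C': "C' \<in> carrier_mat n n" "det C' \<noteq> 0" and e': "\<And>i. i < n \<Longrightarrow> e' i > 0"
    and Y: "\<And>t. (Y1 \<sharp>\<^bsub>t\<^esub> Y2) = diag_congruence n C' (\<lambda>i. e' i powr t)"
    and Y1: "Y1 = diag_congruence n C' (\<lambda>_. 1)" and Y2: "Y2 = diag_congruence n C' e'"
    using geodesic_point_diag_congruence[OF assms(3,4)] by blast
  \<comment> \<open>\<open>P\<close> is the determinant of the product at parameter 0 and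
    \<open>E\<close> the product of all ratios, so the determinant at parameter \<open>t\<close> is
    \<open>P * E powr t\<close>.\<close>
  define P where "P = (cmod (det C))\<^sup>2 * (cmod (det C'))\<^sup>2"
  define E where "E = (\<Prod>i=0..<n. e i * e' i)"
  have P: "P > 0" using C C' by (simp add: P_def)
  have E: "E > 0" unfolding E_def by (intro prod_pos) (auto intro: mult_pos_pos e e')
  have det_prod: "Re (det (diag_congruence n C p * diag_congruence n C' q)) = P * (\<Prod>i=0..<n. p i * q i)" for p q
    using C(1) C'(1)
    by (simp only: det_mult[of _ n] det_diag_congruence diag_congruence_carrier Re_complex_of_real flip: of_real_mult)
      (simp add: P_def prod.distrib)
  have det_t: "Re (det ((X1 \<sharp>\<^bsub>t\<^esub> X2) * (Y1 \<sharp>\<^bsub>t\<^esub> Y2))) = P * E powr t"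
  proof -
    have "(\<Prod>i=0..<n. e i powr t * e' i powr t) = (\<Prod>i=0..<n. (e i * e' i) powr t)"
      by (intro prod.cong refl) (auto simp: powr_mult less_imp_le e e')
    also have "\<dots> = E powr t"
      unfolding E_def by (rule prod_powr_distrib[symmetric])
    finally show ?thesis by (simp add: X Y det_prod)
  qed
  have det_0: "Re (det (X1 * Y1)) = P" by (simp add: X1 Y1 det_prod)
  have det_1: "Re (det (X2 * Y2)) = P * E" by (simp add: X2 Y2 det_prod E_def)
  have "det ((1/2) \<cdot>\<^sub>m (X1 + Y1)) = of_real ((1/2)^n) * det (X1 + Y1)"
    using carrier_matD(2)[OF hpd_matsD(1)[OF assms(3)]] by simp
  hence "Re (det ((1/2) \<cdot>\<^sub>m (X1 + Y1))) = (1/2)^n * Re (det (X1 + Y1))"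
    by (simp only: Re_complex_of_real Im_complex_of_real times_complex.sel)
  hence pos: "Re (det ((1/2) \<cdot>\<^sub>m (X1 + Y1))) > 0"
    using hpd_det_pos[OF hpd_mats_add[OF assms(1,3)]] by simp
  have sum_part: "ln (Re (det ((1/2) \<cdot>\<^sub>m ((X1 \<sharp>\<^bsub>t\<^esub> X2) + (Y1 \<sharp>\<^bsub>t\<^esub> Y2)))))
    \<le> (1 - t) * ln (Re (det ((1/2) \<cdot>\<^sub>m (X1 + Y1)))) + t * ln (Re (det ((1/2) \<cdot>\<^sub>m (X2 + Y2))))"
    \<comment> \<open>The geodesic points have to be rewritten first: replacing \<open>X2\<close>
      and \<open>Y2\<close> would destroy the patterns that \<open>X\<close> and \<open>Y\<close>
      match.\<close>
    unfolding X Y unfolding X2 Y2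
    by (rule ln_det_midpoint_convex[of C n C' e e' t, folded X1 Y1, OF C(1) C'(1) e e' assms(5,6) pos])
  \<comment> \<open>This term enters \<open>delta_S_sq\<close> with a negative sign, where convexity
    would point the wrong way; being affine in \<open>t\<close>, it gives an equality.\<close>
  have det_part: "ln (P * E powr t) = (1 - t) * ln P + t * ln (P * E)"
    using P E by (simp add: ln_mult ln_powr algebra_simps)
  have regroup: "(1 - t) * (b - 1/2 * p) + t * (c - 1/2 * q) = ((1 - t) * b + t * c) - 1/2 * ((1 - t) * p + t * q)"
    for b c p q :: real
    by (simp add: field_simps)
  show ?thesis
    unfolding delta_S_sq_def det_t det_0 det_1 regroup det_part
    by (rule diff_right_mono[OF sum_part])
qed

end
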